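(* Suppose that $M$ is a finite-dimensional complex left Leibniz algebra with derived subalgebra $M'$ and radical $R$. Then $M$ is a symmetric Leibniz algebra if, and only if, $M'\subseteq R$.
   Context: A left Leibniz algebra is a (nonassociative) $\mathbb{C}$-algebra $M$ with product $[\ ]$ satisfying $[a[bc]]=[[ab]c]+[b[ac]]$ for all $a,b,c\in M$. A right Leibniz algebra is one for which each map $b\mapsto[ba]$ is a derivation. A symmetric Leibniz algebra is an algebra that is both a left and a right Leibniz algebra. All algebras are finite-dimensional over $\mathbb{C}$. $M'=[MM]$ is the span of all brackets $[ab]$, $a,b\in M$. With $\psi(a,b)=[ab]+[ba]$, the radical is $R=\{x\in M\mid\psi(x,a)=0\text{ for all }a\in M\}$. *)

theory Defs
  imports Complex_Main
begin

text \<open>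
  The underlying vector space is the whole type \<open>'a\<close>, with complex scalar multiplication \<open>scale\<close>.
  The product \<open>br\<close> is bilinear and is not assumed to be associative, commutative or unital.
\<close>

locale fd_complex_algebra = vector_space scale
  for scale :: "complex \<Rightarrow> 'a::ab_group_add \<Rightarrow> 'a" +
  fixes br :: "'a \<Rightarrow> 'a \<Rightarrow> 'a"
  assumes finite_dim: "\<exists>B. finite_dimensional_vector_space scale B"
    and linear_br_right: "\<And>a. Vector_Spaces.linear scale scale (\<lambda>b. br a b)"
    and linear_br_left: "\<And>b. Vector_Spaces.linear scale scale (\<lambda>a. br a b)"

definition derivation ::
    "(complex \<Rightarrow> 'a::ab_group_add \<Rightarrow> 'a) \<Rightarrow> ('a \<Rightarrow> 'a \<Rightarrow> 'a) \<Rightarrow> ('a \<Rightarrow> 'a) \<Rightarrow> bool" where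
  "derivation scale br D \<longleftrightarrow>
     Vector_Spaces.linear scale scale D \<and> (\<forall>b c. D (br b c) = br (D b) c + br b (D c))"

locale left_leibniz_algebra = fd_complex_algebra +
  assumes left_leibniz: "\<And>a b c. br a (br b c) = br (br a b) c + br b (br a c)"

locale right_leibniz_algebra = fd_complex_algebra +
  assumes right_leibniz: "\<And>a. derivation scale br (\<lambda>b. br b a)"

locale symmetric_leibniz_algebra = left_leibniz_algebra + right_leibniz_algebra

definition derived_subalgebra ::
    "(complex \<Rightarrow> 'a::ab_group_add \<Rightarrow> 'a) \<Rightarrow> ('a \<Rightarrow> 'a \<Rightarrow> 'a) \<Rightarrow> 'a set" where
  "derived_subalgebra scale br = module.span scale {br a b | a b. True}"

definition symmetrized_bracket ::
    "('a::ab_group_add \<Rightarrow> 'a \<Rightarrow> 'a) \<Rightarrow> 'a \<Rightarrow> 'a \<Rightarrow> 'a" where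
  "symmetrized_bracket br a b = br a b + br b a"

definition radical :: "('a::ab_group_add \<Rightarrow> 'a \<Rightarrow> 'a) \<Rightarrow> 'a set" where
  "radical br = {x. \<forall>a. symmetrized_bracket br x a = 0}"

end

theory Submission
  imports Defs
begin

text \<open>
  In a left Leibniz algebra \<open>\<psi>(a,b)\<close> annihilates from the left. Adding the left and right Leibniz
  identities therefore turns the right identity for the triple \<open>a, b, c\<close> into
  \<open>\<psi>(bc, a) = b \<psi>(a,c)\<close>. If the right identity holds, its mirror image of the first remark makes
  the right-hand side vanish; if \<open>M' \<subseteq> R\<close>, then \<open>b \<psi>(a,c) = -\<psi>(a,c) b = 0\<close> because
  \<open>\<psi>(a,c) \<in> M'\<close>.
\<close>

context fd_complex_algebra
begin

lemma br_add_left: "br (a + b) c = br a c + br b c"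
  by (rule module_hom.add[OF Vector_Spaces.linear.axioms(3)[OF linear_br_left[of c]]])

lemma br_add_right: "br a (b + c) = br a b + br a c"
  by (rule module_hom.add[OF Vector_Spaces.linear.axioms(3)[OF linear_br_right[of a]]])

lemma br_scale_left: "br (scale r a) b = scale r (br a b)"
  by (rule module_hom.scale[OF Vector_Spaces.linear.axioms(3)[OF linear_br_left[of b]]])

lemma br_scale_right: "br a (scale r b) = scale r (br a b)"
  by (rule module_hom.scale[OF Vector_Spaces.linear.axioms(3)[OF linear_br_right[of a]]])

lemma br_zero_left: "br 0 a = 0"
  using br_add_left[of 0 0 a] by simp

lemma br_zero_right: "br a 0 = 0"
  using br_add_right[of a 0 0] by simp

text \<open>Bilinearity of \<psi> is the reason. Closure is needed twice: to pass from single
  brackets to their span, and to place the sums \<psi>(a,c) in R.\<close>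

lemma subspace_radical: "subspace (radical br)"
proof (rule subspaceI)
  show "0 \<in> radical br"
    by (simp add: radical_def symmetrized_bracket_def br_zero_left br_zero_right)
next
  fix x y assume "x \<in> radical br" "y \<in> radical br"
  then have "br x a + br a x = 0" "br y a + br a y = 0" for a
    by (auto simp: radical_def symmetrized_bracket_def)
  then have "(br x a + br a x) + (br y a + br a y) = 0" for a
    by simp
  then show "x + y \<in> radical br"
    by (simp add: radical_def symmetrized_bracket_def br_add_left br_add_right algebra_simps)
next
  fix r x assume "x \<in> radical br"
  then show "scale r x \<in> radical br"
    by (simp add: radical_def symmetrized_bracket_def br_scale_left br_scale_right
        flip: scale_right_distrib)
qed

text \<open>Since R is a subspace, the inclusion can be tested on the brackets that span M'.\<close>

lemma derived_subset_radical_iff: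
  "derived_subalgebra scale br \<subseteq> radical br \<longleftrightarrow> (\<forall>a b. br a b \<in> radical br)"
proof
  assume "derived_subalgebra scale br \<subseteq> radical br"
  then show "\<forall>a b. br a b \<in> radical br"
    unfolding derived_subalgebra_def by (blast intro: span_base)
next
  assume "\<forall>a b. br a b \<in> radical br"
  then show "derived_subalgebra scale br \<subseteq> radical br"
    unfolding derived_subalgebra_def by (intro span_minimal subspace_radical) blast
qed

text \<open>The linearity demanded by \<open>derivation\<close> is already part of bilinearity, so
  only the product rule remains.\<close>

lemma right_leibniz_algebra_iff:
  "right_leibniz_algebra scale br \<longleftrightarrow>
    (\<forall>a b c. br (br b c) a = br (br b a) c + br b (br c a))"
  unfolding right_leibniz_algebra_def right_leibniz_algebra_axioms_def derivation_def
  using fd_complex_algebra_axioms linear_br_left by blast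

end

text \<open>By the left identity, left multiplication by \<open>br a b\<close> is the commutator of
  the left multiplications by \<open>a\<close> and \<open>b\<close>, hence changes sign when
  \<open>a\<close> and \<open>b\<close> are swapped.\<close>

lemma (in left_leibniz_algebra) br_symmetrized_left: "br (symmetrized_bracket br a b) c = 0"
proof -
  have "br (br a b) c = br a (br b c) - br b (br a c)" for a b
    by (simp only: left_leibniz[of a b c] add_diff_cancel_right')
  from this[of a b] this[of b a] show ?thesis
    by (simp add: symmetrized_bracket_def br_add_left)
qed

text \<open>Mirror image: right multiplication by \<open>br b a\<close> is a commutator of right
  multiplications. The left identity is not assumed here.\<close>

lemma (in right_leibniz_algebra) br_symmetrized_right: "br c (symmetrized_bracket br a b) = 0"
proof -
  have right: "br (br c b) a = br (br c a) b + br c (br b a)" for a b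
    using right_leibniz[of a] unfolding derivation_def by blast
  have "br c (br b a) = br (br c b) a - br (br c a) b" for a b
    by (simp only: right[of b a] add_diff_cancel_left')
  from this[of a b] this[of b a] show ?thesis
    by (simp add: symmetrized_bracket_def br_add_right)
qed

text \<open>Adding \<open>br a (br b c)\<close> to both sides of the right identity gives the second
  equation, once \<open>br a (br b c) + br (br b a) c\<close> is recognised as
  \<open>br b (br a c)\<close>.\<close>

lemma (in left_leibniz_algebra) right_leibniz_identity_iff:
  "br (br b c) a = br (br b a) c + br b (br c a) \<longleftrightarrow>
    symmetrized_bracket br (br b c) a = br b (symmetrized_bracket br a c)"
proof -
  have "br (br a b) c + br (br b a) c = 0"
    using br_symmetrized_left[of a b c] by (simp add: symmetrized_bracket_def br_add_left)
  then have "br (br a b) c = - br (br b a) c"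
    by (simp add: eq_neg_iff_add_eq_0)
  with left_leibniz[of a b c] have "br b (br a c) = br a (br b c) + br (br b a) c"
    by simp
  then show ?thesis
    by (simp add: symmetrized_bracket_def br_add_right add.commute add.left_commute)
qed

theorem lemma8:
  fixes scale :: "complex \<Rightarrow> 'a::ab_group_add \<Rightarrow> 'a"
    and br :: "'a \<Rightarrow> 'a \<Rightarrow> 'a"
  assumes "left_leibniz_algebra scale br"
  shows "symmetric_leibniz_algebra scale br \<longleftrightarrow> derived_subalgebra scale br \<subseteq> radical br"
proof -
  interpret left_leibniz_algebra scale br by fact
  let ?\<psi> = "symmetrized_bracket br"
  have "symmetric_leibniz_algebra scale br \<longleftrightarrow> right_leibniz_algebra scale br"
    using assms by (simp add: symmetric_leibniz_algebra_def)
  also have "\<dots> \<longleftrightarrow> (\<forall>b c. br b c \<in> radical br)"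
  proof
    assume right: "right_leibniz_algebra scale br"
    then have "?\<psi> (br b c) a = br b (?\<psi> a c)" for a b c
      unfolding right_leibniz_algebra_iff right_leibniz_identity_iff by blast
    then have "?\<psi> (br b c) a = 0" for a b c
      by (simp only: right_leibniz_algebra.br_symmetrized_right[OF right])
    then show "\<forall>b c. br b c \<in> radical br"
      by (simp add: radical_def)
  next
    assume "\<forall>b c. br b c \<in> radical br"
    then have rad: "br b c \<in> radical br" for b c
      by blast
    have "?\<psi> a c \<in> radical br" for a c
      unfolding symmetrized_bracket_def by (intro subspace_add[OF subspace_radical] rad)
    \<comment> \<open>Membership in R is tested against \<open>b\<close>; the first summand vanishes
      in any left Leibniz algebra, which isolates the second.\<close>
    then have "br (?\<psi> a c) b + br b (?\<psi> a c) = 0" for a b c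
      unfolding radical_def by (simp add: symmetrized_bracket_def)
    then have "br b (?\<psi> a c) = 0" for a b c
      by (simp add: br_symmetrized_left)
    \<comment> \<open>Both sides of the reformulated identity are now zero: the left because
      \<open>br b c\<close> lies in R, the right by the previous step.\<close>
    then show "right_leibniz_algebra scale br"
      using rad by (simp add: right_leibniz_algebra_iff right_leibniz_identity_iff radical_def)
  qed
  finally show ?thesis
    by (simp add: derived_subset_radical_iff)
qed

end
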